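(* Let $(A,B)$ be a random vector, $(A_n,B_n)_{n\in\mathbb N}$ i.i.d. copies, $X=\sum_{k\ge1}\Pi_{k-1}B_k$ with $|X|<\infty$ a.s. Assume $\mathbb P\{A=0\}=0$, $\mathbb P\{B=0\}<1$, $\mathbb P\{B+Ac=c\}<1$ for all $c\in\mathbb R$, and $\mathbb P\{A=-1\}=0$. Let $r>0$. (1) If $\mathbb P\{A<0\}\mathbb P\{A>0\}>0$ and $\mathbb P\{B\ge0\}=1$, then $\mathbb E e^{rX}<\infty$ if and only if $\mathbb P\{|A|\le1\}=1$, $\mathbb E e^{rB}<\infty$ and $\mathbb E e^{rB}\mathbf 1_{\{A=1\}}<1$. (2) If $\mathbb P\{A<0\}=1$, then $\mathbb E e^{rX}<\infty$ if and only if $\mathbb P\{|A|\le1\}=1$ and $\mathbb E e^{r(B_1+A_1B_2)}<\infty$.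
   Context: $\Pi_0:=1$, $\Pi_n:=A_1\cdots A_n$. *)

theory Defs
  imports "HOL-Probability.Probability"
begin

definition Pi_prod :: "(nat \<Rightarrow> 'a \<Rightarrow> real) \<Rightarrow> nat \<Rightarrow> 'a \<Rightarrow> real" where
  "Pi_prod A n \<omega> = (\<Prod>i\<in>{1..n}. A i \<omega>)"

text \<open>The perpetuity X = \<Sum>_{k\<ge>1} \<Pi>_{k-1} B_k (reindexed with j = k-1 \<ge> 0).\<close>
definition perpetuity :: "(nat \<Rightarrow> 'a \<Rightarrow> real) \<Rightarrow> (nat \<Rightarrow> 'a \<Rightarrow> real) \<Rightarrow> 'a \<Rightarrow> real" where
  "perpetuity A B \<omega> = (\<Sum>j. Pi_prod A j \<omega> * B (Suc j) \<omega>)"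

end

theory Submission
  imports Defs
begin

text \<open>
  The moment generating function \<open>\<phi>\<close> of \<open>X\<close> is a fixed point of \<open>T g t = E (exp (t B) g (t A))\<close>, while
  that of the \<open>n\<close>-th partial sum is the \<open>n\<close>-th iterate of \<open>T\<close> at the constant \<open>1\<close>.

  If \<open>\<phi> r\<close> is finite and \<open>A\<close> takes negative values, then \<open>\<phi>\<close> is finite on both sides of the origin and
  \<open>X\<close> has all moments. For \<open>m = inf_c E |X - c|^n\<close>, conditioning on \<open>(A, B)\<close> in \<open>X = B + A X'\<close> gives
  \<open>E |A|^n m \<le> m\<close>, and \<open>0 < m < \<infinity>\<close> because \<open>X\<close> is not constant. Hence \<open>E |A|^n \<le> 1\<close> for all \<open>n \<ge> 1\<close>,
  which forces \<open>|A| \<le> 1\<close>. Since \<open>\<phi>\<close> is bounded below by a positive constant on \<open>[-r, r]\<close>, the iterates of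
  \<open>T\<close> at \<open>1\<close> are then finite at \<open>r\<close>; the condition on \<open>{A = 1}\<close> is read off from \<open>\<phi> r = T \<phi> r\<close>.

  Conversely, for \<open>0 \<le> A \<le> 1\<close> and \<open>B \<ge> 0\<close> a function \<open>f t = 1 + K1 t + K2 t^m\<close> satisfies \<open>T f \<le> f\<close> on
  \<open>[0, r]\<close>, so all iterates of \<open>T\<close> at \<open>1\<close> are bounded by \<open>f\<close>, and Fatou's lemma bounds \<open>\<phi>\<close>. Part (1) is
  compared with the pair \<open>(|A|, B)\<close>, part (2) with \<open>(A1 A2, max 0 (B1 + A1 B2))\<close>, whose operator
  dominates \<open>T\<close> composed with itself.
\<close>

section \<open>Iterates of the smoothing operator\<close>

text \<open>If \<open>g\<close> is the moment generating function of a \<open>Y\<close> independent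
  of \<open>(A, B)\<close>, this is the one of \<open>B + A Y\<close>. The measure is a parameter
  because the operator is also used on a product space.\<close>

definition affine_smoothing :: "'b measure \<Rightarrow> ('b \<Rightarrow> real) \<Rightarrow> ('b \<Rightarrow> real) \<Rightarrow> (real \<Rightarrow> ennreal) \<Rightarrow> real \<Rightarrow> ennreal"
  where "affine_smoothing N A B g t = (\<integral>\<^sup>+x. ennreal (exp (t * B x)) * g (t * A x) \<partial>N)"

lemma affine_smoothing_measurable:
  assumes "sigma_finite_measure N" and [measurable]: "A \<in> borel_measurable N" "B \<in> borel_measurable N"
    "g \<in> borel_measurable borel"
  shows "affine_smoothing N A B g \<in> borel_measurable borel"
proof -
  interpret sigma_finite_measure N by fact
  show ?thesis unfolding affine_smoothing_def by measurable
qed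

lemma iterate_affine_smoothing_measurable:
  assumes "sigma_finite_measure N" "A \<in> borel_measurable N" "B \<in> borel_measurable N" "g \<in> borel_measurable borel"
  shows "(affine_smoothing N A B ^^ n) g \<in> borel_measurable borel"
  using assms by (induction n) (auto intro: affine_smoothing_measurable)

section \<open>A Lyapunov function for the smoothing operator\<close>

text \<open>Convexity of \<open>exp\<close> between \<open>0\<close> and \<open>r * b\<close>, with
  the weight \<open>1 - t / r\<close> of the endpoint \<open>0\<close> enlarged to \<open>1\<close>.
  The error term keeps the small factor \<open>t / r\<close>.\<close>

lemma exp_le_chord:
  fixes t r b :: real
  assumes "0 \<le> t" "t \<le> r" "0 < r"
  shows "exp (t * b) \<le> 1 + t / r * exp (r * b)"
proof -
  have "exp ((1 - t / r) * 0 + (t / r) * (r * b)) \<le> (1 - t / r) * exp 0 + (t / r) * exp (r * b)"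
    using assms by (intro convex_onD[of UNIV exp, simplified]) (auto simp: exp_convex)
  also have "\<dots> \<le> 1 + t / r * exp (r * b)" using assms by auto
  finally show ?thesis using assms by simp
qed

text \<open>Two contractions cooperate, both supplied by \<open>less1\<close>: the mean of
  \<open>A\<close> is below \<open>1\<close> and shrinks a linear term, and the mean of
  \<open>exp (r * B) * A ^ m\<close> is below \<open>1\<close> for a suitable \<open>m\<close> and
  shrinks a power term. The bound \<open>1 \<le> f t\<close> lets an iteration start at the constant
  \<open>1\<close>.\<close>

lemma affine_smoothing_Lyapunov:
  fixes A B :: "'b \<Rightarrow> real" and r :: real
  assumes "prob_space N" and [measurable]: "A \<in> borel_measurable N" "B \<in> borel_measurable N"
    and r: "0 < r" and A01: "AE x in N. 0 \<le> A x \<and> A x \<le> 1" and B0: "\<And>x. 0 \<le> B x"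
    and fin: "(\<integral>\<^sup>+x. ennreal (exp (r * B x)) \<partial>N) < \<infinity>"
    and less1: "(\<integral>\<^sup>+x. ennreal (exp (r * B x) * indicator {x. A x = 1} x) \<partial>N) < 1"
  obtains f :: "real \<Rightarrow> real" where "\<And>t. 0 \<le> t \<Longrightarrow> 1 \<le> f t"
    and "\<And>t. \<lbrakk>0 \<le> t; t \<le> r\<rbrakk> \<Longrightarrow> affine_smoothing N A B (\<lambda>s. ennreal (f s)) t \<le> ennreal (f t)"
proof -
  interpret prob_space N by fact
  let ?E = "\<lambda>x. exp (r * B x)"
  define D where "D = (\<integral>x. ?E x \<partial>N)"
  define \<alpha> where "\<alpha> = (\<integral>x. A x \<partial>N)"
  have intE: "integrable N ?E" using fin by (intro integrableI_nonneg) auto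
  have intA: "integrable N A" using A01 by (intro integrable_const_bound[of _ 1]) auto
  have int1: "integrable N (\<lambda>x. ?E x * indicator {x. A x = 1} x)"
    by (rule Bochner_Integration.integrable_bound[OF intE]) (auto split: split_indicator)
  have E1: "1 \<le> ?E x" for x using r B0[of x] by simp
  have D1: "1 \<le> D" unfolding D_def using integral_mono[OF _ intE, of "\<lambda>_. 1"] E1 by (simp add: prob_space)
  have L1: "(\<integral>x. ?E x * indicator {x. A x = 1} x \<partial>N) < 1"
    using less1 by (subst (asm) nn_integral_eq_integral[OF int1]) auto
  \<comment> \<open>Otherwise \<open>A = 1\<close> almost everywhere, and the integral in
    \<open>less1\<close> is all of \<open>D\<close>, which is at least \<open>1\<close>.\<close>
  have \<alpha>1: "\<alpha> < 1"
  proof (rule ccontr)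
    assume "\<not> \<alpha> < 1"
    moreover have "0 \<le> (\<integral>x. 1 - A x \<partial>N)" using A01 by (intro integral_nonneg_AE) auto
    moreover have "(\<integral>x. 1 - A x \<partial>N) = 1 - \<alpha>" using intA by (simp add: \<alpha>_def prob_space)
    ultimately have "(\<integral>x. 1 - A x \<partial>N) = 0" by simp
    then have "AE x in N. 1 - A x = 0"
      using intA A01 by (subst (asm) integral_nonneg_eq_0_iff_AE) auto
    then have "(\<integral>x. ?E x * indicator {x. A x = 1} x \<partial>N) = D"
      unfolding D_def by (intro integral_cong_AE) auto
    with L1 D1 show False by simp
  qed
  \<comment> \<open>For \<open>0 \<le> A \<le> 1\<close> the powers of \<open>A\<close> tend to the
    indicator of \<open>A = 1\<close>, so the strict inequality in \<open>less1\<close> already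
    holds at a finite exponent \<open>m\<close>.\<close>
  have "(\<lambda>n. \<integral>x. ?E x * A x ^ n \<partial>N) \<longlonglongrightarrow> (\<integral>x. ?E x * indicator {x. A x = 1} x \<partial>N)"
  proof (rule integral_dominated_convergence[OF _ _ intE])
    show "AE x in N. (\<lambda>n. ?E x * A x ^ n) \<longlonglongrightarrow> ?E x * indicator {x. A x = 1} x"
      using A01
    proof eventually_elim
      case (elim x)
      then show ?case by (cases "A x = 1") (auto intro!: tendsto_mult_right_zero LIMSEQ_realpow_zero)
    qed
    show "AE x in N. norm (?E x * A x ^ n) \<le> ?E x" for n
      using A01 by eventually_elim (auto simp: abs_mult power_le_one power_abs intro!: mult_left_le)
  qed auto
  from order_tendstoD(2)[OF this L1] obtain m where m: "(\<integral>x. ?E x * A x ^ m \<partial>N) < 1"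
    by (auto simp: eventually_sequentially)
  define \<rho> where "\<rho> = (\<integral>x. ?E x * A x ^ m \<partial>N)"
  have intm: "integrable N (\<lambda>x. ?E x * A x ^ m)"
  proof (rule Bochner_Integration.integrable_bound[OF intE])
    show "AE x in N. norm (?E x * A x ^ m) \<le> norm (?E x)"
      using A01 by eventually_elim (auto simp: abs_mult power_le_one power_abs intro!: mult_left_le)
  qed auto
  \<comment> \<open>The term \<open>K1 t\<close> yields \<open>T f \<le> f\<close> up to \<open>t0\<close>; beyond \<open>t0\<close> the term \<open>K2 t^m\<close> absorbs all errors.\<close>
  define K1 where "K1 = 2 * D / (r * (1 - \<alpha>))"
  define t0 where "t0 = r * (1 - \<alpha>) / (2 * D)"
  define K2 where "K2 = (D + K1 * D * r) / ((1 - \<rho>) * t0 ^ m)"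
  have pos: "0 < K1" "0 < t0" "0 < 1 - \<rho>" using r \<alpha>1 D1 m by (auto simp: K1_def t0_def \<rho>_def)
  have K2: "0 < K2" using pos D1 r unfolding K2_def by (intro divide_pos_pos add_pos_nonneg mult_pos_pos) auto
  define f where "f t = 1 + K1 * t + K2 * t ^ m" for t
  show ?thesis
  proof
    show "1 \<le> f t" if "0 \<le> t" for t using that pos K2 by (simp add: f_def)
    fix t assume t: "0 \<le> t" "t \<le> r"
    \<comment> \<open>A majorant linear in \<open>?E\<close>, \<open>A\<close> and
      \<open>?E * A ^ m\<close>, so that its integral involves only \<open>D\<close>,
      \<open>\<alpha>\<close> and \<open>\<rho>\<close>. The factor \<open>exp (t * B)\<close> is
      bounded by the chord in the first two terms of \<open>f\<close> and crudely by
      \<open>?E\<close> in the power term.\<close>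
    let ?g = "\<lambda>x. 1 + t / r * ?E x + K1 * t * (A x + t / r * ?E x) + K2 * t ^ m * (?E x * A x ^ m)"
    have "AE x in N. exp (t * B x) * f (t * A x) \<le> ?g x"
      using A01
    proof eventually_elim
      case (elim x)
      have e1: "exp (t * B x) \<le> 1 + t / r * ?E x" by (rule exp_le_chord) (use t r in auto)
      have e2: "exp (t * B x) \<le> ?E x" using t B0 by (simp add: mult_right_mono)
      have "A x * exp (t * B x) \<le> A x * (1 + t / r * ?E x)" using e1 elim by (intro mult_left_mono) auto
      also have "\<dots> \<le> A x + t / r * ?E x"
        using elim t r mult_right_mono[of "A x" 1 "t / r * ?E x"] by (simp add: algebra_simps)
      finally have e3: "K1 * t * (A x * exp (t * B x)) \<le> K1 * t * (A x + t / r * ?E x)"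
        using t pos by (intro mult_left_mono) auto
      have e4: "K2 * t ^ m * (exp (t * B x) * A x ^ m) \<le> K2 * t ^ m * (?E x * A x ^ m)"
        using e2 elim K2 t by (intro mult_left_mono mult_right_mono) auto
      show ?case using e1 e3 e4 by (simp add: f_def algebra_simps power_mult_distrib)
    qed
    then have "affine_smoothing N A B (\<lambda>s. ennreal (f s)) t \<le> (\<integral>\<^sup>+x. ennreal (?g x) \<partial>N)"
      unfolding affine_smoothing_def
      by (intro nn_integral_mono_AE) (auto simp: ennreal_mult'[symmetric] intro!: ennreal_leI)
    also have "\<dots> = ennreal (\<integral>x. ?g x \<partial>N)"
    proof (rule nn_integral_eq_integral)
      show "integrable N ?g" using intE intA intm by auto
      show "AE x in N. 0 \<le> ?g x" using A01 by eventually_elim (use t r pos K2 in auto)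
    qed
    also have "(\<integral>x. ?g x \<partial>N) = 1 + t / r * D + K1 * t * (\<alpha> + t / r * D) + K2 * t ^ m * \<rho>"
      using intE intA intm by (simp add: D_def \<alpha>_def \<rho>_def prob_space)
    also have "\<dots> \<le> f t"
    proof -
      \<comment> \<open>This is the desired inequality after cancelling \<open>1\<close> and moving
        the linear terms to the left and the power terms to the right.\<close>
      have "t * (D / r + K1 * (\<alpha> - 1 + t * D / r)) \<le> K2 * (1 - \<rho>) * t ^ m"
      proof (cases "t \<le> t0")
        case True
        \<comment> \<open>Up to \<open>t0\<close> at least half of the gain
          \<open>1 - \<alpha>\<close> survives, and \<open>K1\<close> is chosen so that this half
          pays exactly for \<open>D / r\<close>.\<close>
        then have "t * D / r \<le> t0 * D / r" using D1 r by (intro divide_right_mono mult_right_mono) auto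
        also have "\<dots> = (1 - \<alpha>) / 2" using r D1 by (simp add: t0_def)
        finally have "K1 * (\<alpha> - 1 + t * D / r) \<le> K1 * (- (1 - \<alpha>) / 2)"
          using pos by (intro mult_left_mono) auto
        also have "\<dots> = - D / r" using r \<alpha>1 by (simp add: K1_def field_simps)
        finally have "t * (D / r + K1 * (\<alpha> - 1 + t * D / r)) \<le> 0"
          using t by (simp add: mult_nonneg_nonpos)
        also have "0 \<le> K2 * (1 - \<rho>) * t ^ m" using K2 pos t by auto
        finally show ?thesis .
      next
        case False
        \<comment> \<open>On all of \<open>[0, r]\<close> the left side is at most
          \<open>D + K1 * D * r\<close>, and \<open>K2\<close> is chosen so that the right side
          reaches this value at \<open>t0\<close>.\<close>
        have "t * D / r \<le> D" using t r D1 by (simp add: field_simps mult_right_mono)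
        then have "K1 * (\<alpha> - 1 + t * D / r) \<le> K1 * D" using pos \<alpha>1 by (intro mult_left_mono) auto
        then have "t * (D / r + K1 * (\<alpha> - 1 + t * D / r)) \<le> t * (D / r + K1 * D)"
          using t by (intro mult_left_mono) auto
        also have "\<dots> \<le> r * (D / r + K1 * D)" using t pos D1 r by (intro mult_right_mono) auto
        also have "\<dots> = K2 * (1 - \<rho>) * t0 ^ m" using pos r by (simp add: K2_def field_simps)
        also have "\<dots> \<le> K2 * (1 - \<rho>) * t ^ m" using False pos K2 by (intro mult_left_mono power_mono) auto
        finally show ?thesis .
      qed
      then show ?thesis by (simp add: f_def algebra_simps)
    qed
    finally show "affine_smoothing N A B (\<lambda>s. ennreal (f s)) t \<le> ennreal (f t)"
      by (simp add: ennreal_leI)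
  qed
qed

text \<open>The Lyapunov function of \<open>(\<bar>A\<bar>, max 0 B)\<close>, evaluated at
  \<open>\<bar>t\<bar>\<close>, dominates every iterate. This rests on
  \<open>t * B \<le> \<bar>t\<bar> * max 0 B\<close>, which holds if \<open>B\<close> is nonnegative
  or if \<open>t\<close> is; the second case persists under \<open>t \<mapsto> t * A\<close> when
  \<open>A\<close> is nonnegative.\<close>

lemma affine_smoothing_iterates_bounded:
  fixes A B :: "'b \<Rightarrow> real" and r :: real
  assumes "prob_space N" and [measurable]: "A \<in> borel_measurable N" "B \<in> borel_measurable N"
    and r: "0 < r" and A1: "AE x in N. \<bar>A x\<bar> \<le> 1"
    and nonneg: "(AE x in N. 0 \<le> A x) \<or> (AE x in N. 0 \<le> B x)"
    and fin: "(\<integral>\<^sup>+x. ennreal (exp (r * B x)) \<partial>N) < \<infinity>"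
    and less1: "(\<integral>\<^sup>+x. ennreal (exp (r * max 0 (B x)) * indicator {x. \<bar>A x\<bar> = 1} x) \<partial>N) < 1"
  obtains C :: real where "\<And>n. (affine_smoothing N A B ^^ n) (\<lambda>_. 1) r \<le> ennreal C"
proof -
  interpret prob_space N by fact
  have "(\<integral>\<^sup>+x. ennreal (exp (r * max 0 (B x))) \<partial>N) \<le> (\<integral>\<^sup>+x. 1 + ennreal (exp (r * B x)) \<partial>N)"
    by (intro nn_integral_mono) (auto simp: max_def ennreal_1[symmetric] ennreal_plus[symmetric] simp del: ennreal_1 ennreal_plus)
  also have "\<dots> < \<infinity>" using fin by (subst nn_integral_add) (auto simp: emeasure_space_1)
  finally have "(\<integral>\<^sup>+x. ennreal (exp (r * max 0 (B x))) \<partial>N) < \<infinity>" .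
  with affine_smoothing_Lyapunov[OF \<open>prob_space N\<close>, of "\<lambda>x. \<bar>A x\<bar>" "\<lambda>x. max 0 (B x)" r] r A1 less1
  obtain f where f: "\<And>t. 0 \<le> t \<Longrightarrow> 1 \<le> f t"
    "\<And>t. \<lbrakk>0 \<le> t; t \<le> r\<rbrakk> \<Longrightarrow> affine_smoothing N (\<lambda>x. \<bar>A x\<bar>) (\<lambda>x. max 0 (B x)) (\<lambda>s. ennreal (f s)) t \<le> ennreal (f t)"
    by auto
  \<comment> \<open>A set of arguments that contains \<open>r\<close> and is almost surely stable
    under multiplication by \<open>A\<close>; the induction has to cover all of it.\<close>
  define J where "J = (if AE x in N. 0 \<le> A x then {0..r} else {-r..r})"
  have J: "\<bar>t\<bar> \<le> r" if "t \<in> J" for t using that by (auto simp: J_def split: if_splits)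
  have "(affine_smoothing N A B ^^ n) (\<lambda>_. 1) t \<le> ennreal (f \<bar>t\<bar>)" if "t \<in> J" for n t
    using that
  proof (induction n arbitrary: t)
    case 0
    then show ?case using f(1)[of "\<bar>t\<bar>"] ennreal_leI by fastforce
  next
    case (Suc n)
    have mono: "\<bar>t\<bar> * \<bar>a\<bar> \<le> r" if "\<bar>a\<bar> \<le> 1" for a
      using J[OF Suc.prems] that mult_mono[of "\<bar>t\<bar>" r "\<bar>a\<bar>" 1] by auto
    have TJ: "AE x in N. t * A x \<in> J"
    proof (cases "AE x in N. 0 \<le> A x")
      case True
      then have "0 \<le> t" using Suc.prems by (auto simp: J_def)
      from True A1 show ?thesis
      proof eventually_elim
        case (elim x)
        with mono[of "A x"] \<open>0 \<le> t\<close> True show ?case by (simp add: J_def)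
      qed
    next
      case False
      then show ?thesis using A1 by (auto elim!: eventually_mono dest!: mono simp: J_def abs_mult[symmetric])
    qed
    have TB: "AE x in N. t * B x \<le> \<bar>t\<bar> * max 0 (B x)"
    proof (cases "AE x in N. 0 \<le> A x")
      case True
      then have "0 \<le> t" using Suc.prems by (auto simp: J_def)
      then show ?thesis by (auto simp: mult_left_mono)
    next
      case False
      with nonneg have "AE x in N. 0 \<le> B x" by auto
      then show ?thesis by eventually_elim (auto simp: mult_right_mono)
    qed
    have "(affine_smoothing N A B ^^ Suc n) (\<lambda>_. 1) t
        = (\<integral>\<^sup>+x. ennreal (exp (t * B x)) * (affine_smoothing N A B ^^ n) (\<lambda>_. 1) (t * A x) \<partial>N)"
      by (simp add: affine_smoothing_def)
    also have "\<dots> \<le> (\<integral>\<^sup>+x. ennreal (exp (\<bar>t\<bar> * max 0 (B x))) * ennreal (f (\<bar>t\<bar> * \<bar>A x\<bar>)) \<partial>N)"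
    proof (rule nn_integral_mono_AE)
      show "AE x in N. ennreal (exp (t * B x)) * (affine_smoothing N A B ^^ n) (\<lambda>_. 1) (t * A x)
         \<le> ennreal (exp (\<bar>t\<bar> * max 0 (B x))) * ennreal (f (\<bar>t\<bar> * \<bar>A x\<bar>))"
        using TJ TB
      proof eventually_elim
        case (elim x)
        then show ?case using Suc.IH[of "t * A x"]
          by (intro mult_mono) (auto simp: abs_mult ennreal_leI)
      qed
    qed
    also have "\<dots> \<le> ennreal (f \<bar>t\<bar>)" using f(2)[of "\<bar>t\<bar>"] J[OF Suc.prems] by (simp add: affine_smoothing_def)
    finally show ?case .
  qed
  moreover have "r \<in> J" using r by (auto simp: J_def)
  ultimately show ?thesis using that[of "f \<bar>r\<bar>"] by blast
qed

section \<open>Affine distributional fixed points\<close>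

text \<open>A single term of the exponential series is at most its sum.\<close>

lemma power_le_fact_exp:
  fixes y :: real
  assumes "0 \<le> y"
  shows "y ^ n \<le> fact n * exp y"
proof -
  have "(\<Sum>k\<in>{n}. y ^ k /\<^sub>R fact k) \<le> exp y"
    unfolding exp_def using assms by (intro sum_le_suminf summable_exp_generic) auto
  then show ?thesis by (simp add: field_simps)
qed

lemma nn_integral_abs_power_finite:
  fixes X :: "'a \<Rightarrow> real"
  assumes [measurable]: "X \<in> borel_measurable M" and s: "0 < s"
    and fin: "(\<integral>\<^sup>+\<omega>. ennreal (exp (s * X \<omega>)) \<partial>M) < \<infinity>" "(\<integral>\<^sup>+\<omega>. ennreal (exp (- s * X \<omega>)) \<partial>M) < \<infinity>"
  shows "(\<integral>\<^sup>+\<omega>. ennreal (\<bar>X \<omega>\<bar> ^ n) \<partial>M) < \<infinity>"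
proof -
  let ?c = "fact n / s ^ n"
  have bound: "\<bar>x\<bar> ^ n \<le> ?c * (exp (s * x) + exp (- s * x))" for x
  proof -
    have "(s * \<bar>x\<bar>) ^ n \<le> fact n * exp (s * \<bar>x\<bar>)" using s by (intro power_le_fact_exp) auto
    also have "\<dots> \<le> fact n * (exp (s * x) + exp (- s * x))" by (intro mult_left_mono) (auto simp: abs_if)
    finally show ?thesis using s by (simp add: field_simps power_mult_distrib)
  qed
  have "(\<integral>\<^sup>+\<omega>. ennreal (\<bar>X \<omega>\<bar> ^ n) \<partial>M)
      \<le> (\<integral>\<^sup>+\<omega>. ennreal ?c * (ennreal (exp (s * X \<omega>)) + ennreal (exp (- s * X \<omega>))) \<partial>M)"
    using bound s by (intro nn_integral_mono)
      (simp add: ennreal_plus[symmetric] ennreal_mult'[symmetric] ennreal_leI del: ennreal_plus)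
  also have "\<dots> = ennreal ?c * ((\<integral>\<^sup>+\<omega>. ennreal (exp (s * X \<omega>)) \<partial>M) + (\<integral>\<^sup>+\<omega>. ennreal (exp (- s * X \<omega>)) \<partial>M))"
    by (subst nn_integral_cmult, simp, subst nn_integral_add) auto
  also have "\<dots> < \<infinity>" using fin by (auto simp: ennreal_mult_less_top)
  finally show ?thesis .
qed

text \<open>The distributional identity \<open>X = B + A X'\<close>, where the copy
  \<open>X'\<close> of \<open>X\<close> is independent of \<open>(A, B)\<close>. The iterated
  integral expresses this independence without enlarging the probability space.\<close>

locale affine_fixed_point = prob_space M for M :: "'a measure" +
  fixes A B X :: "'a \<Rightarrow> real"
  assumes A_measurable[measurable]: "A \<in> borel_measurable M"
    and B_measurable[measurable]: "B \<in> borel_measurable M"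
    and X_measurable[measurable]: "X \<in> borel_measurable M"
    and A_nonzero: "AE \<omega> in M. A \<omega> \<noteq> 0"
    and fixed_point: "\<And>h. h \<in> borel_measurable borel \<Longrightarrow>
      (\<integral>\<^sup>+\<omega>. h (X \<omega>) \<partial>M) = (\<integral>\<^sup>+\<omega>. \<integral>\<^sup>+\<omega>'. h (B \<omega> + A \<omega> * X \<omega>') \<partial>M \<partial>M)"
begin

definition mgf :: "real \<Rightarrow> ennreal"
  where "mgf t = (\<integral>\<^sup>+\<omega>. ennreal (exp (t * X \<omega>)) \<partial>M)"

lemma mgf_measurable[measurable]: "mgf \<in> borel_measurable borel"
  unfolding mgf_def by measurable

lemma affine_smoothing_mgf: "affine_smoothing M A B mgf = mgf"
proof
  fix t
  have "mgf t = (\<integral>\<^sup>+\<omega>. \<integral>\<^sup>+\<omega>'. ennreal (exp (t * (B \<omega> + A \<omega> * X \<omega>'))) \<partial>M \<partial>M)"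
    unfolding mgf_def by (rule fixed_point) measurable
  also have "\<dots> = affine_smoothing M A B mgf t"
    unfolding affine_smoothing_def mgf_def
    by (subst nn_integral_cmult[symmetric])
      (auto intro!: nn_integral_cong simp: ennreal_mult'[symmetric] exp_add[symmetric] algebra_simps)
  finally show "affine_smoothing M A B mgf t = mgf t" by simp
qed

text \<open>The chord inequality on \<open>[0, 1]\<close> carries finiteness of \<open>mgf\<close>
  from a point to the whole segment joining it to the origin.\<close>

lemma mgf_scale_le:
  assumes u: "0 \<le> u" "u \<le> 1"
  shows "mgf (u * t) \<le> 1 + mgf t"
proof -
  have "exp (u * t * x) \<le> 1 + exp (t * x)" for x
  proof -
    have "exp (u * (t * x)) \<le> 1 + u / 1 * exp (1 * (t * x))" by (rule exp_le_chord) (use u in auto)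
    also have "\<dots> \<le> 1 + exp (t * x)" using u mult_right_mono[of u 1 "exp (t * x)"] by simp
    finally show ?thesis by (simp only: mult.assoc)
  qed
  then have "mgf (u * t) \<le> (\<integral>\<^sup>+\<omega>. 1 + ennreal (exp (t * X \<omega>)) \<partial>M)"
    unfolding mgf_def
    by (intro nn_integral_mono)
      (simp add: ennreal_1[symmetric] ennreal_plus[symmetric] ennreal_leI del: ennreal_1 ennreal_plus)
  also have "\<dots> = 1 + mgf t" unfolding mgf_def by (subst nn_integral_add) (auto simp: emeasure_space_1)
  finally show ?thesis .
qed

text \<open>Finiteness of \<open>mgf r\<close>, read through the fixed point equation, makes
  \<open>mgf (r * A \<omega>)\<close> finite for almost every \<open>\<omega>\<close>. Since
  \<open>A\<close> is negative with positive probability, \<open>mgf\<close> is finite at some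
  negative point as well.\<close>

lemma abs_moments_finite:
  assumes r: "0 < r" and fin: "mgf r < \<infinity>" and neg: "\<not> (AE \<omega> in M. 0 \<le> A \<omega>)"
  shows "(\<integral>\<^sup>+\<omega>. ennreal (\<bar>X \<omega>\<bar> ^ n) \<partial>M) < \<infinity>"
proof -
  have "(\<integral>\<^sup>+\<omega>. ennreal (exp (r * B \<omega>)) * mgf (r * A \<omega>) \<partial>M) \<noteq> \<infinity>"
    using fin fun_cong[OF affine_smoothing_mgf, of r] by (simp add: affine_smoothing_def)
  then have "AE \<omega> in M. ennreal (exp (r * B \<omega>)) * mgf (r * A \<omega>) \<noteq> \<infinity>"
    by (intro nn_integral_PInf_AE) auto
  then have AE: "AE \<omega> in M. mgf (r * A \<omega>) < \<infinity>"
    by eventually_elim (simp add: ennreal_mult_eq_top_iff less_top)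
  have "\<exists>a<0. mgf (r * a) < \<infinity>"
  proof (rule ccontr)
    assume "\<not> (\<exists>a<0. mgf (r * a) < \<infinity>)"
    then have "0 \<le> A \<omega>" if "mgf (r * A \<omega>) < \<infinity>" for \<omega> using that not_le by blast
    with AE have "AE \<omega> in M. 0 \<le> A \<omega>" by (rule eventually_mono)
    with neg show False by contradiction
  qed
  then obtain a where a: "a < 0" "mgf (r * a) < \<infinity>" by blast
  have ra: "r * a < 0" using r a(1) by (rule mult_pos_neg)
  \<comment> \<open>The smaller distance to the origin, so that \<open>s\<close> and
    \<open>- s\<close> lie on the segments from \<open>0\<close> to \<open>r\<close> and from
    \<open>0\<close> to \<open>r * a\<close>.\<close>
  define s where "s = min r (- (r * a))"
  have s: "0 < s" "s \<le> r" "s \<le> - (r * a)" using r ra by (simp_all add: s_def)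
  have "mgf (s / r * r) \<le> 1 + mgf r" using s r by (intro mgf_scale_le) simp_all
  moreover have "mgf (s / - (r * a) * (r * a)) \<le> 1 + mgf (r * a)"
  proof (rule mgf_scale_le)
    have "0 < - (r * a)" using ra by simp
    then show "0 \<le> s / - (r * a)" "s / - (r * a) \<le> 1"
      using s by (simp_all only: divide_le_eq_1_pos zero_le_divide_iff) simp
  qed
  moreover have "s / r * r = s" "s / - (r * a) * (r * a) = - s" using r a(1) by simp_all
  ultimately have "mgf s \<le> 1 + mgf r" "mgf (- s) \<le> 1 + mgf (r * a)" by simp_all
  moreover have "1 + mgf r < \<infinity>" "1 + mgf (r * a) < \<infinity>" using fin a(2) by simp_all
  ultimately have "mgf s < \<infinity>" "mgf (- s) < \<infinity>" using le_less_trans by blast+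
  then show ?thesis using s(1) by (intro nn_integral_abs_power_finite[of X M s]) (simp_all add: mgf_def)
qed

section \<open>Moments of the multiplier\<close>

text \<open>Taking the infimum over all centres removes \<open>B\<close>: given
  \<open>(A, B)\<close>, the moment of \<open>B + A X'\<close> about \<open>c\<close> is
  \<open>\<bar>A\<bar> ^ n\<close> times the moment of \<open>X'\<close> about another centre, hence
  at least \<open>\<bar>A\<bar> ^ n * m\<close>.\<close>

lemma abs_moment_le_1:
  assumes nonconst: "\<And>c. \<not> (AE \<omega> in M. X \<omega> = c)" and n: "0 < n"
    and fin: "(\<integral>\<^sup>+\<omega>. ennreal (\<bar>X \<omega>\<bar> ^ n) \<partial>M) < \<infinity>"
  shows "(\<integral>\<^sup>+\<omega>. ennreal (\<bar>A \<omega>\<bar> ^ n) \<partial>M) \<le> 1"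
proof -
  define I where "I c = (\<integral>\<^sup>+\<omega>. ennreal (\<bar>X \<omega> - c\<bar> ^ n) \<partial>M)" for c
  define m where "m = (INF c. I c)"
  \<comment> \<open>Comparing two independent copies of \<open>X\<close> bounds the infimum away
    from \<open>0\<close>: \<open>K\<close> does not depend on a centre, is nonzero for nonconstant
    \<open>X\<close>, and \<open>K / 2\<close> lies below every \<open>I c\<close>.\<close>
  define K where "K = (\<integral>\<^sup>+\<omega>. \<integral>\<^sup>+\<omega>'. ennreal ((\<bar>X \<omega> - X \<omega>'\<bar> / 2) ^ n) \<partial>M \<partial>M)"
  have "K \<noteq> 0"
  proof
    assume "K = 0"
    then have "AE \<omega> in M. (\<integral>\<^sup>+\<omega>'. ennreal ((\<bar>X \<omega> - X \<omega>'\<bar> / 2) ^ n) \<partial>M) = 0"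
      unfolding K_def by (subst (asm) nn_integral_0_iff_AE) auto
    then obtain \<omega> where "(\<integral>\<^sup>+\<omega>'. ennreal ((\<bar>X \<omega> - X \<omega>'\<bar> / 2) ^ n) \<partial>M) = 0"
      using eventually_happens'[OF ae_filter_bot] by blast
    then have "AE \<omega>' in M. ennreal ((\<bar>X \<omega> - X \<omega>'\<bar> / 2) ^ n) = 0"
      by (subst (asm) nn_integral_0_iff_AE) auto
    then have "AE \<omega>' in M. X \<omega>' = X \<omega>"
      by eventually_elim (use n in \<open>auto simp: ennreal_eq_0_iff power_le_zero_eq\<close>)
    with nonconst show False by blast
  qed
  have "K \<le> I c * 2" for c
  proof -
    have "((\<bar>x - y\<bar> / 2) ^ n) \<le> \<bar>x - c\<bar> ^ n + \<bar>y - c\<bar> ^ n" for x y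
    proof -
      have "(\<bar>x - y\<bar> / 2) ^ n \<le> (max \<bar>x - c\<bar> \<bar>y - c\<bar>) ^ n"
        by (intro power_mono) (auto simp: max_def abs_if split: if_splits)
      also have "\<dots> \<le> \<bar>x - c\<bar> ^ n + \<bar>y - c\<bar> ^ n" by (auto simp: max_def)
      finally show ?thesis .
    qed
    then have "K \<le> (\<integral>\<^sup>+\<omega>. \<integral>\<^sup>+\<omega>'. ennreal (\<bar>X \<omega> - c\<bar> ^ n) + ennreal (\<bar>X \<omega>' - c\<bar> ^ n) \<partial>M \<partial>M)"
      unfolding K_def by (intro nn_integral_mono) (auto simp: ennreal_plus[symmetric] ennreal_leI simp del: ennreal_plus)
    also have "\<dots> = (\<integral>\<^sup>+\<omega>. ennreal (\<bar>X \<omega> - c\<bar> ^ n) + I c \<partial>M)"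
      by (subst nn_integral_add) (auto simp: I_def emeasure_space_1)
    also have "\<dots> = I c + I c"
      by (subst nn_integral_add) (auto simp: I_def[symmetric] emeasure_space_1)
    finally show ?thesis by (simp add: mult_2_right)
  qed
  then have "K / 2 \<le> m" unfolding m_def by (intro INF_greatest divide_le_posI_ennreal) (auto simp: mult.commute)
  moreover have "K / 2 \<noteq> 0" using \<open>K \<noteq> 0\<close> by (simp add: ennreal_divide_eq_0_iff)
  ultimately have "m \<noteq> 0" by (metis le_zero_eq)
  have "m \<le> I 0" unfolding m_def by (rule INF_lower) simp
  also have "I 0 < \<infinity>" using fin by (simp add: I_def)
  finally have "m \<noteq> \<infinity>" by simp
  have "(\<integral>\<^sup>+\<omega>. ennreal (\<bar>A \<omega>\<bar> ^ n) \<partial>M) * m \<le> I c" for c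
  proof -
    have "(\<integral>\<^sup>+\<omega>. ennreal (\<bar>A \<omega>\<bar> ^ n) \<partial>M) * m = (\<integral>\<^sup>+\<omega>. ennreal (\<bar>A \<omega>\<bar> ^ n) * m \<partial>M)"
      by (rule nn_integral_multc[symmetric]) simp
    also have "\<dots> \<le> (\<integral>\<^sup>+\<omega>. \<integral>\<^sup>+\<omega>'. ennreal (\<bar>B \<omega> + A \<omega> * X \<omega>' - c\<bar> ^ n) \<partial>M \<partial>M)"
    proof (rule nn_integral_mono_AE)
      show "AE \<omega> in M. ennreal (\<bar>A \<omega>\<bar> ^ n) * m \<le> (\<integral>\<^sup>+\<omega>'. ennreal (\<bar>B \<omega> + A \<omega> * X \<omega>' - c\<bar> ^ n) \<partial>M)"
        using A_nonzero
      proof eventually_elim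
        case (elim \<omega>)
        \<comment> \<open>The new centre requires division by \<open>A \<omega>\<close>, hence
          \<open>A_nonzero\<close>.\<close>
        have "B \<omega> + A \<omega> * x - c = A \<omega> * (x - (c - B \<omega>) / A \<omega>)" for x
          using elim by (simp add: field_simps)
        then have "(\<integral>\<^sup>+\<omega>'. ennreal (\<bar>B \<omega> + A \<omega> * X \<omega>' - c\<bar> ^ n) \<partial>M) = ennreal (\<bar>A \<omega>\<bar> ^ n) * I ((c - B \<omega>) / A \<omega>)"
          unfolding I_def by (subst nn_integral_cmult[symmetric]) (auto simp: abs_mult power_mult_distrib ennreal_mult')
        moreover have "m \<le> I ((c - B \<omega>) / A \<omega>)" unfolding m_def by (rule INF_lower) simp
        ultimately show ?case by (simp add: mult_left_mono)
      qed
    qed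
    also have "\<dots> = I c" unfolding I_def by (rule fixed_point[symmetric]) measurable
    finally show ?thesis .
  qed
  then have "(\<integral>\<^sup>+\<omega>. ennreal (\<bar>A \<omega>\<bar> ^ n) \<partial>M) * m \<le> m" by (subst (2) m_def) (rule INF_greatest)
  then have "(\<integral>\<^sup>+\<omega>. ennreal (\<bar>A \<omega>\<bar> ^ n) \<partial>M) * m \<le> 1 * m" by simp
  with \<open>m \<noteq> 0\<close> \<open>m \<noteq> \<infinity>\<close> show ?thesis
    by (subst (asm) (1 2) mult.commute, subst (asm) ennreal_mult_le_mult_iff) auto
qed

text \<open>By Fatou's lemma the lower limit of the powers of \<open>\<bar>A\<bar>\<close> has
  integral at most \<open>1\<close>, yet this limit is infinite wherever
  \<open>\<bar>A\<bar> > 1\<close>.\<close>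

lemma abs_le_1:
  assumes nonconst: "\<And>c. \<not> (AE \<omega> in M. X \<omega> = c)"
    and r: "0 < r" "mgf r < \<infinity>" and neg: "\<not> (AE \<omega> in M. 0 \<le> A \<omega>)"
  shows "AE \<omega> in M. \<bar>A \<omega>\<bar> \<le> 1"
proof -
  have "(\<integral>\<^sup>+\<omega>. liminf (\<lambda>n. ennreal (\<bar>A \<omega>\<bar> ^ Suc n)) \<partial>M) \<le> liminf (\<lambda>n. \<integral>\<^sup>+\<omega>. ennreal (\<bar>A \<omega>\<bar> ^ Suc n) \<partial>M)"
    by (rule nn_integral_liminf) measurable
  also have "\<dots> \<le> 1"
    using abs_moment_le_1[OF nonconst zero_less_Suc abs_moments_finite[OF r neg]]
    by (intro Liminf_le[OF sequentially_bot] always_eventually allI)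
  finally have "(\<integral>\<^sup>+\<omega>. liminf (\<lambda>n. ennreal (\<bar>A \<omega>\<bar> ^ Suc n)) \<partial>M) \<noteq> \<infinity>"
    by (metis ennreal_one_less_top infinity_ennreal_def not_le)
  then have "AE \<omega> in M. liminf (\<lambda>n. ennreal (\<bar>A \<omega>\<bar> ^ Suc n)) \<noteq> \<infinity>"
    by (intro nn_integral_PInf_AE) auto
  then show ?thesis
  proof eventually_elim
    case (elim \<omega>)
    show ?case
    proof (rule ccontr)
      assume "\<not> \<bar>A \<omega>\<bar> \<le> 1"
      then have "filterlim (\<lambda>n. \<bar>A \<omega>\<bar> ^ Suc n) at_top sequentially"
        using filterlim_realpow_sequentially_gt1[of "\<bar>A \<omega>\<bar>"]
        by (subst filterlim_sequentially_Suc) (auto simp: filterlim_at_infinity_conv_norm_at_top power_abs)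
      then have "(\<lambda>n. ennreal (\<bar>A \<omega>\<bar> ^ Suc n)) \<longlonglongrightarrow> \<infinity>"
        by (simp add: ennreal_tendsto_top_eq_at_top)
      with elim show False using lim_imp_Liminf[OF sequentially_bot] by blast
    qed
  qed
qed

section \<open>Necessary conditions from a finite moment generating function\<close>

text \<open>The positive function \<open>exp (- r * \<bar>X\<bar>)\<close> lies below
  \<open>exp (t * X)\<close> whenever \<open>\<bar>t\<bar> \<le> r\<close>. The minimum with
  \<open>1\<close> keeps the constant finite for every sign of \<open>r\<close>.\<close>

lemma mgf_lower_bound:
  obtains c where "0 < c" "c < \<infinity>" "\<And>t. \<bar>t\<bar> \<le> r \<Longrightarrow> c \<le> mgf t"
proof -
  define c where "c = (\<integral>\<^sup>+\<omega>. ennreal (exp (- r * \<bar>X \<omega>\<bar>)) \<partial>M)"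
  have "c \<noteq> 0" unfolding c_def using emeasure_space_1 by (subst nn_integral_0_iff_AE) auto
  then have "0 < min 1 c" by (auto simp: zero_less_iff_neq_zero min_def)
  moreover have "min 1 c < \<infinity>" by (simp add: min_less_iff_disj)
  moreover have "min 1 c \<le> mgf t" if "\<bar>t\<bar> \<le> r" for t
  proof -
    have "- r * \<bar>x\<bar> \<le> t * x" for x
    proof -
      have "\<bar>t * x\<bar> \<le> r * \<bar>x\<bar>" using that by (simp add: abs_mult mult_right_mono)
      then show ?thesis by auto
    qed
    then have "c \<le> mgf t" unfolding c_def mgf_def by (intro nn_integral_mono ennreal_leI) simp
    then show ?thesis by (simp add: min.coboundedI2)
  qed
  ultimately show ?thesis using that[of "min 1 c"] by blast
qed

text \<open>On \<open>[-r, r]\<close> the constant \<open>c\<close> lies below the fixed point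
  \<open>mgf\<close>. The operator is monotone and homogeneous, and this interval is stable under
  multiplication by \<open>A\<close>, so \<open>c\<close> times any iterate at \<open>1\<close>
  stays below \<open>mgf\<close>.\<close>

lemma finite_iterate:
  assumes "AE \<omega> in M. \<bar>A \<omega>\<bar> \<le> 1" "mgf r < \<infinity>" "0 < r"
  shows "(affine_smoothing M A B ^^ n) (\<lambda>_. 1) r < \<infinity>"
proof -
  obtain c where c: "0 < c" "c < \<infinity>" "\<And>t. \<bar>t\<bar> \<le> r \<Longrightarrow> c \<le> mgf t"
    using mgf_lower_bound[of r] by blast
  have "c * (affine_smoothing M A B ^^ n) (\<lambda>_. 1) t \<le> mgf t" if "\<bar>t\<bar> \<le> r" for t
    using that
  proof (induction n arbitrary: t)
    case 0
    then show ?case using c by simp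
  next
    case (Suc n)
    have "c * (affine_smoothing M A B ^^ Suc n) (\<lambda>_. 1) t =
      (\<integral>\<^sup>+\<omega>. c * (ennreal (exp (t * B \<omega>)) * (affine_smoothing M A B ^^ n) (\<lambda>_. 1) (t * A \<omega>)) \<partial>M)"
      using iterate_affine_smoothing_measurable[OF sigma_finite_measure_axioms A_measurable B_measurable, of "\<lambda>_. 1" n]
      by (simp add: affine_smoothing_def nn_integral_cmult)
    also have "\<dots> \<le> (\<integral>\<^sup>+\<omega>. ennreal (exp (t * B \<omega>)) * mgf (t * A \<omega>) \<partial>M)"
    proof (rule nn_integral_mono_AE)
      show "AE \<omega> in M. c * (ennreal (exp (t * B \<omega>)) * (affine_smoothing M A B ^^ n) (\<lambda>_. 1) (t * A \<omega>))
         \<le> ennreal (exp (t * B \<omega>)) * mgf (t * A \<omega>)"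
        using assms(1)
      proof eventually_elim
        case (elim \<omega>)
        have "\<bar>t * A \<omega>\<bar> \<le> r"
          using Suc.prems elim mult_mono[of "\<bar>t\<bar>" r "\<bar>A \<omega>\<bar>" 1] by (auto simp: abs_mult)
        from mult_left_mono[OF Suc.IH[OF this], of "ennreal (exp (t * B \<omega>))"]
        show ?case by (simp add: mult.left_commute)
      qed
    qed
    also have "\<dots> = affine_smoothing M A B mgf t" by (simp add: affine_smoothing_def)
    finally show ?case by (simp add: affine_smoothing_mgf)
  qed
  then have "c * (affine_smoothing M A B ^^ n) (\<lambda>_. 1) r \<le> mgf r" using assms by simp
  then have "c * (affine_smoothing M A B ^^ n) (\<lambda>_. 1) r < \<infinity>" using assms(2) by (rule le_less_trans)
  then show ?thesis using c by (auto simp: ennreal_mult_less_top)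
qed

text \<open>Splitting the fixed point equation at \<open>A = 1\<close> gives
  \<open>mgf r = mgf r * ?J + ?R\<close>. If \<open>?J\<close> were at least \<open>1\<close>, the
  remainder \<open>?R\<close> would vanish, and positivity of \<open>mgf\<close> would force
  \<open>A = 1\<close> almost everywhere.\<close>

lemma nn_integral_exp_indicator_less_1:
  assumes "mgf r < \<infinity>" and "\<not> (AE \<omega> in M. A \<omega> = 1)"
  shows "(\<integral>\<^sup>+\<omega>. ennreal (exp (r * B \<omega>) * indicator {\<omega>. A \<omega> = 1} \<omega>) \<partial>M) < 1" (is "?J < 1")
proof (rule ccontr)
  assume "\<not> ?J < 1"
  have pos: "0 < mgf t" for t using mgf_lower_bound[of "\<bar>t\<bar>"] by (metis less_le_trans order_refl)
  let ?R = "\<integral>\<^sup>+\<omega>. ennreal (exp (r * B \<omega>)) * mgf (r * A \<omega>) * indicator {\<omega>. A \<omega> \<noteq> 1} \<omega> \<partial>M"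
  have "mgf r = (\<integral>\<^sup>+\<omega>. ennreal (exp (r * B \<omega>)) * mgf (r * A \<omega>) \<partial>M)"
    using affine_smoothing_mgf by (metis affine_smoothing_def)
  also have "\<dots> = (\<integral>\<^sup>+\<omega>. mgf r * ennreal (exp (r * B \<omega>) * indicator {\<omega>. A \<omega> = 1} \<omega>)
     + ennreal (exp (r * B \<omega>)) * mgf (r * A \<omega>) * indicator {\<omega>. A \<omega> \<noteq> 1} \<omega> \<partial>M)"
    by (intro nn_integral_cong) (auto simp: mult.commute split: split_indicator)
  also have "\<dots> = mgf r * ?J + ?R"
    by (subst nn_integral_add) (auto simp: nn_integral_cmult)
  finally have eq: "mgf r = mgf r * ?J + ?R" .
  have "mgf r * 1 \<le> mgf r * ?J" using \<open>\<not> ?J < 1\<close> by (intro mult_left_mono) auto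
  then have "mgf r + ?R \<le> mgf r * ?J + ?R" by (intro add_right_mono) simp
  then have "mgf r + ?R \<le> mgf r" using eq by simp
  then have "mgf r + ?R \<le> mgf r + 0" by simp
  \<comment> \<open>Cancelling \<open>mgf r\<close> is legitimate because it is finite.\<close>
  then have "?R = 0" using assms(1) by (subst (asm) ennreal_add_left_cancel_le) auto
  then have "AE \<omega> in M. ennreal (exp (r * B \<omega>)) * mgf (r * A \<omega>) * indicator {\<omega>. A \<omega> \<noteq> 1} \<omega> = 0"
    by (subst (asm) nn_integral_0_iff_AE) auto
  then have "AE \<omega> in M. A \<omega> = 1"
    by eventually_elim (use pos in \<open>auto split: split_indicator_asm simp: less_le\<close>)
  with assms(2) show False by blast
qed
end

section \<open>Perpetuities\<close>

text \<open>The law of the sequence is an infinite power of one measure, and prepending an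
  independent coordinate leaves such a power unchanged. Since only laws matter, the first coordinate
  may be taken to be \<open>W\<close>.\<close>

lemma iid_first_step:
  assumes "prob_space M" and [measurable]: "\<And>n. Z n \<in> measurable M N" "W \<in> measurable M N"
    and ind: "prob_space.indep_vars M (\<lambda>_. N) Z {1..}"
    and dist: "\<And>n. n \<ge> 1 \<Longrightarrow> distr M N (Z n) = distr M N W"
    and H[measurable]: "H \<in> borel_measurable (\<Pi>\<^sub>M i\<in>(UNIV::nat set). N)"
  shows "(\<integral>\<^sup>+\<omega>. H (\<lambda>n. Z (Suc n) \<omega>) \<partial>M) =
     (\<integral>\<^sup>+\<omega>. \<integral>\<^sup>+\<omega>'. H (case_nat (W \<omega>) (\<lambda>n. Z (Suc n) \<omega>')) \<partial>M \<partial>M)"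
proof -
  interpret prob_space M by fact
  define \<mu> where "\<mu> = distr M N W"
  interpret \<mu>: prob_space \<mu> unfolding \<mu>_def by (rule prob_space_distr) simp
  interpret S: sequence_space \<mu> ..
  let ?S = "S.S"
  have [measurable_cong]: "sets \<mu> = sets N" by (simp add: \<mu>_def)
  have S_sets[measurable_cong]: "sets S.S = sets (\<Pi>\<^sub>M i\<in>(UNIV::nat set). N)" by (intro sets_PiM_cong) (auto simp: \<mu>_def)
  let ?P1 = "\<Pi>\<^sub>M i\<in>{1::nat..}. \<mu>"
  have law1: "distr M (\<Pi>\<^sub>M i\<in>{1..}. N) (\<lambda>x. \<lambda>i\<in>{1..}. Z i x) = ?P1"
    using indep_vars_iff_distr_eq_PiM[of "{1..}" Z "\<lambda>_. N"] ind dist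
    by (auto simp: \<mu>_def intro!: PiM_cong)
  have shift: "(\<lambda>\<omega>. \<lambda>n\<in>UNIV. \<omega> (Suc n)) \<in> measurable (\<Pi>\<^sub>M i\<in>{1..}. N) S.S"
    by (rule measurable_restrict) (auto intro!: measurable_component_singleton simp: \<mu>_def)
  have law: "distr M S.S (\<lambda>\<omega> n. Z (Suc n) \<omega>) = S.S"
  proof -
    \<comment> \<open>The random variables are indexed from \<open>1\<close>; reindexing along
      \<open>Suc\<close> turns their product measure into the one over all naturals.\<close>
    have "distr ?P1 S.S (\<lambda>\<omega>. \<lambda>n\<in>UNIV. \<omega> (Suc n)) = S.S"
      using distr_PiM_reindex[of "{1..}" "\<lambda>_. \<mu>" Suc UNIV] \<mu>.prob_space_axioms by auto
    moreover have "distr ?P1 S.S (\<lambda>\<omega>. \<lambda>n\<in>UNIV. \<omega> (Suc n)) = distr M S.S (\<lambda>\<omega> n. Z (Suc n) \<omega>)"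
      unfolding law1[symmetric]
      using shift by (subst distr_distr) (auto simp: comp_def restrict_UNIV)
    ultimately show ?thesis by simp
  qed
  have mZ: "(\<lambda>\<omega> n. Z (Suc n) \<omega>) \<in> measurable M S.S" by (rule measurable_PiM_single') (auto simp: \<mu>_def space_PiM measurable_space[OF assms(2)])
  have [measurable]: "H \<in> borel_measurable S.S" using H S_sets measurable_cong_sets by blast
  have "(\<integral>\<^sup>+\<omega>. H (\<lambda>n. Z (Suc n) \<omega>) \<partial>M) = (\<integral>\<^sup>+s. H s \<partial>S.S)"
    using nn_integral_distr[OF mZ, of H] by (simp add: law)
  also have "\<dots> = (\<integral>\<^sup>+p. H (case p of (s, \<omega>) \<Rightarrow> case_nat s \<omega>) \<partial>(\<mu> \<Otimes>\<^sub>M S.S))"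
    by (subst S.PiM_iter[symmetric], subst nn_integral_distr) auto
  also have "\<dots> = (\<integral>\<^sup>+z. \<integral>\<^sup>+s. H (case_nat z s) \<partial>S.S \<partial>\<mu>)"
    by (subst S.P.nn_integral_fst[symmetric]) auto
  also have "\<dots> = (\<integral>\<^sup>+z. \<integral>\<^sup>+\<omega>'. H (case_nat z (\<lambda>n. Z (Suc n) \<omega>')) \<partial>M \<partial>\<mu>)"
  proof (rule nn_integral_cong)
    fix z assume z: "z \<in> space \<mu>"
    then have [simp]: "z \<in> space N" by (simp add: \<mu>_def)
    show "(\<integral>\<^sup>+s. H (case_nat z s) \<partial>S.S) = (\<integral>\<^sup>+\<omega>'. H (case_nat z (\<lambda>n. Z (Suc n) \<omega>')) \<partial>M)"
      using z nn_integral_distr[OF mZ, of "\<lambda>s. H (case_nat z s)"] by (simp add: law)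
  qed
  also have "\<dots> = (\<integral>\<^sup>+\<omega>. \<integral>\<^sup>+\<omega>'. H (case_nat (W \<omega>) (\<lambda>n. Z (Suc n) \<omega>')) \<partial>M \<partial>M)"
  proof -
    have "(\<lambda>(z, \<omega>'). case_nat z (\<lambda>n. Z (Suc n) \<omega>')) \<in> measurable (N \<Otimes>\<^sub>M M) S.S"
      using measurable_compose[OF measurable_snd mZ] by measurable
    then have "(\<lambda>(z, \<omega>'). H (case_nat z (\<lambda>n. Z (Suc n) \<omega>'))) \<in> borel_measurable (N \<Otimes>\<^sub>M M)"
      by (simp add: case_prod_unfold measurable_compose)
    then show ?thesis unfolding \<mu>_def by (subst nn_integral_distr) auto
  qed
  finally show ?thesis .
qed

text \<open>Terms of the series as functions on sequence space, indexed from \<open>0\<close>, so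
  that the first step becomes prepending a pair by \<open>case_nat\<close>.\<close>

definition perpetuity_term :: "(nat \<Rightarrow> real \<times> real) \<Rightarrow> nat \<Rightarrow> real"
  where "perpetuity_term s j = (\<Prod>i<j. fst (s i)) * snd (s j)"

lemma perpetuity_term_case_nat:
  "perpetuity_term (case_nat z s) 0 = snd z"
  "perpetuity_term (case_nat z s) (Suc j) = fst z * perpetuity_term s j"
  by (simp_all add: perpetuity_term_def prod.lessThan_Suc_shift del: prod.lessThan_Suc)

lemma perpetuity_term_measurable[measurable]:
  "(\<lambda>s. perpetuity_term s j) \<in> borel_measurable (\<Pi>\<^sub>M i\<in>(UNIV::nat set). borel)"
proof -
  have coord: "(\<lambda>s. s i) \<in> measurable (\<Pi>\<^sub>M i\<in>(UNIV::nat set). borel :: (real \<times> real) measure) borel" for i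
    by (rule measurable_component_singleton) simp
  have "fst \<in> borel_measurable (borel :: (real \<times> real) measure)" "snd \<in> borel_measurable (borel :: (real \<times> real) measure)"
    by (intro borel_measurable_continuous_onI continuous_intros)+
  note [measurable] = measurable_compose[OF coord this(1)] measurable_compose[OF coord this(2)]
  show ?thesis unfolding perpetuity_term_def by (intro borel_measurable_times borel_measurable_prod) measurable
qed

locale iid_perpetuity = prob_space M for M :: "'a measure" +
  fixes A B :: "'a \<Rightarrow> real" and As Bs :: "nat \<Rightarrow> 'a \<Rightarrow> real"
  assumes A_measurable[measurable]: "A \<in> borel_measurable M"
    and B_measurable[measurable]: "B \<in> borel_measurable M"
    and As_measurable[measurable]: "\<And>n. As n \<in> borel_measurable M"
    and Bs_measurable[measurable]: "\<And>n. Bs n \<in> borel_measurable M"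
    and indep: "indep_vars (\<lambda>_. borel) (\<lambda>n \<omega>. (As n \<omega>, Bs n \<omega>)) {1..}"
    and ident: "\<And>n. n \<ge> 1 \<Longrightarrow>
           distr M borel (\<lambda>\<omega>. (As n \<omega>, Bs n \<omega>)) = distr M borel (\<lambda>\<omega>. (A \<omega>, B \<omega>))"
    and summable: "AE \<omega> in M. summable (\<lambda>j. Pi_prod As j \<omega> * Bs (Suc j) \<omega>)"
    and A_nonzero: "AE \<omega> in M. A \<omega> \<noteq> 0"
begin

abbreviation X :: "'a \<Rightarrow> real" where "X \<equiv> perpetuity As Bs"

abbreviation coeffs :: "'a \<Rightarrow> nat \<Rightarrow> real \<times> real"
  where "coeffs \<omega> \<equiv> \<lambda>n. (As (Suc n) \<omega>, Bs (Suc n) \<omega>)"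

definition partial_perpetuity :: "nat \<Rightarrow> 'a \<Rightarrow> real"
  where "partial_perpetuity n \<omega> = (\<Sum>j<n. Pi_prod As j \<omega> * Bs (Suc j) \<omega>)"

lemma term_eq: "Pi_prod As j \<omega> * Bs (Suc j) \<omega> = perpetuity_term (coeffs \<omega>) j"
  by (simp add: Pi_prod_def perpetuity_term_def prod.atLeast1_atMost_eq)

lemma partial_perpetuity_measurable[measurable]: "partial_perpetuity n \<in> borel_measurable M"
  unfolding partial_perpetuity_def Pi_prod_def by measurable

lemma X_measurable[measurable]: "X \<in> borel_measurable M"
  unfolding perpetuity_def[abs_def] Pi_prod_def by measurable

lemma coeffs_first_step:
  assumes "H \<in> borel_measurable (\<Pi>\<^sub>M i\<in>(UNIV::nat set). borel)"
  shows "(\<integral>\<^sup>+\<omega>. H (coeffs \<omega>) \<partial>M) = (\<integral>\<^sup>+\<omega>. \<integral>\<^sup>+\<omega>'. H (case_nat (A \<omega>, B \<omega>) (coeffs \<omega>')) \<partial>M \<partial>M)"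
  by (rule iid_first_step[OF prob_space_axioms _ _ indep ident assms]) (auto intro: borel_measurable_Pair)

lemma partial_perpetuity_step:
  fixes h :: "real \<Rightarrow> ennreal"
  assumes [measurable]: "h \<in> borel_measurable borel"
  shows "(\<integral>\<^sup>+\<omega>. h (partial_perpetuity (Suc n) \<omega>) \<partial>M)
      = (\<integral>\<^sup>+\<omega>. \<integral>\<^sup>+\<omega>'. h (B \<omega> + A \<omega> * partial_perpetuity n \<omega>') \<partial>M \<partial>M)"
  using coeffs_first_step[of "\<lambda>s. h (\<Sum>j<Suc n. perpetuity_term s j)"]
  by (simp add: partial_perpetuity_def term_eq sum.lessThan_Suc_shift perpetuity_term_case_nat
      sum_distrib_left del: sum.lessThan_Suc)

text \<open>Prepending \<open>(a, b)\<close> to the coefficients of a series with sum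
  \<open>x\<close> gives a series with sum \<open>b + a * x\<close>.\<close>

lemma X_step:
  fixes h :: "real \<Rightarrow> ennreal"
  assumes [measurable]: "h \<in> borel_measurable borel"
  shows "(\<integral>\<^sup>+\<omega>. h (X \<omega>) \<partial>M) = (\<integral>\<^sup>+\<omega>. \<integral>\<^sup>+\<omega>'. h (B \<omega> + A \<omega> * X \<omega>') \<partial>M \<partial>M)"
proof -
  have "(\<integral>\<^sup>+\<omega>. h (X \<omega>) \<partial>M)
      = (\<integral>\<^sup>+\<omega>. \<integral>\<^sup>+\<omega>'. h (\<Sum>j. perpetuity_term (case_nat (A \<omega>, B \<omega>) (coeffs \<omega>')) j) \<partial>M \<partial>M)"
    using coeffs_first_step[of "\<lambda>s. h (\<Sum>j. perpetuity_term s j)"] by (simp add: perpetuity_def term_eq)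
  also have "\<dots> = (\<integral>\<^sup>+\<omega>. \<integral>\<^sup>+\<omega>'. h (B \<omega> + A \<omega> * X \<omega>') \<partial>M \<partial>M)"
  proof (rule nn_integral_cong, rule nn_integral_cong_AE)
    fix \<omega>
    \<comment> \<open>The value of a divergent series is unspecified, so the algebra is valid only
      where the series converges.\<close>
    show "AE \<omega>' in M. h (\<Sum>j. perpetuity_term (case_nat (A \<omega>, B \<omega>) (coeffs \<omega>')) j) = h (B \<omega> + A \<omega> * X \<omega>')"
      using summable
    proof eventually_elim
      case (elim \<omega>')
      then have sm: "(\<lambda>j. perpetuity_term (coeffs \<omega>') j) sums X \<omega>'"
        by (simp add: perpetuity_def term_eq summable_sums)
      then have "(\<lambda>j. perpetuity_term (case_nat (A \<omega>, B \<omega>) (coeffs \<omega>')) (Suc j)) sums (A \<omega> * X \<omega>')"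
        unfolding perpetuity_term_case_nat fst_conv by (rule sums_mult)
      then have "(\<lambda>j. perpetuity_term (case_nat (A \<omega>, B \<omega>) (coeffs \<omega>')) j) sums (A \<omega> * X \<omega>' + B \<omega>)"
        by (subst (asm) sums_Suc_iff) (simp add: perpetuity_term_case_nat)
      then show ?case by (simp add: sums_iff add.commute)
    qed
  qed
  finally show ?thesis .
qed

sublocale affine_fixed_point M A B X
  by unfold_locales (auto intro: A_nonzero X_step)

text \<open>If \<open>X = c\<close> almost everywhere, the fixed point identity for the indicator of
  the complement of \<open>c\<close> gives \<open>B + A * c = c\<close> almost everywhere.\<close>

lemma X_nonconst:
  assumes "prob {\<omega> \<in> space M. B \<omega> + A \<omega> * c = c} < 1"
  shows "\<not> (AE \<omega> in M. X \<omega> = c)"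
proof
  assume c: "AE \<omega> in M. X \<omega> = c"
  have "(\<integral>\<^sup>+\<omega>. indicator {x. x \<noteq> c} (B \<omega> + A \<omega> * c) \<partial>M)
      = (\<integral>\<^sup>+\<omega>. \<integral>\<^sup>+\<omega>'. indicator {x. x \<noteq> c} (B \<omega> + A \<omega> * c) \<partial>M \<partial>M)"
    by (simp add: emeasure_space_1)
  also have "\<dots> = (\<integral>\<^sup>+\<omega>. \<integral>\<^sup>+\<omega>'. indicator {x. x \<noteq> c} (B \<omega> + A \<omega> * X \<omega>') \<partial>M \<partial>M)"
    by (rule nn_integral_cong, rule nn_integral_cong_AE, rule eventually_mono[OF c]) simp
  also have "\<dots> = (\<integral>\<^sup>+\<omega>. indicator {x. x \<noteq> c} (X \<omega>) \<partial>M)"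
    by (rule X_step[symmetric]) measurable
  also have "\<dots> = (\<integral>\<^sup>+\<omega>. 0 \<partial>M)"
    by (rule nn_integral_cong_AE, rule eventually_mono[OF c]) simp
  also have "\<dots> = 0" by simp
  finally have "AE \<omega> in M. indicator {x. x \<noteq> c} (B \<omega> + A \<omega> * c) = (0::ennreal)"
    by (subst (asm) nn_integral_0_iff_AE) auto
  then have "AE \<omega> in M. B \<omega> + A \<omega> * c = c"
    by eventually_elim (auto split: split_indicator_asm)
  then have "prob {\<omega> \<in> space M. B \<omega> + A \<omega> * c = c} = 1"
    by (subst prob_Collect_eq_1) auto
  with assms show False by simp
qed

section \<open>Sufficient conditions through partial sums\<close>

lemma iterate_eq_partial_perpetuity_mgf:
  "(affine_smoothing M A B ^^ n) (\<lambda>_. 1) t = (\<integral>\<^sup>+\<omega>. ennreal (exp (t * partial_perpetuity n \<omega>)) \<partial>M)"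
proof (induction n arbitrary: t)
  case 0
  then show ?case by (simp add: partial_perpetuity_def emeasure_space_1)
next
  case (Suc n)
  have "(affine_smoothing M A B ^^ Suc n) (\<lambda>_. 1) t
     = (\<integral>\<^sup>+\<omega>. \<integral>\<^sup>+\<omega>'. ennreal (exp (t * (B \<omega> + A \<omega> * partial_perpetuity n \<omega>'))) \<partial>M \<partial>M)"
    unfolding funpow.simps comp_def affine_smoothing_def[of _ _ _ "(affine_smoothing M A B ^^ n) (\<lambda>_. 1)"] Suc.IH
    by (subst nn_integral_cmult[symmetric])
      (auto intro!: nn_integral_cong simp: ennreal_mult'[symmetric] exp_add[symmetric] algebra_simps)
  also have "\<dots> = (\<integral>\<^sup>+\<omega>. ennreal (exp (t * partial_perpetuity (Suc n) \<omega>)) \<partial>M)"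
    by (rule partial_perpetuity_step[symmetric]) measurable
  finally show ?case .
qed

text \<open>Fatou's lemma for the partial sums. Passing to multiples of \<open>k\<close> allows a
  bound that is known for even iterates only.\<close>

lemma mgf_le:
  assumes k: "0 < k" and bound: "\<And>n. (affine_smoothing M A B ^^ (k * n)) (\<lambda>_. 1) t \<le> C"
  shows "mgf t \<le> C"
proof -
  have "mgf t = (\<integral>\<^sup>+\<omega>. liminf (\<lambda>n. ennreal (exp (t * partial_perpetuity (k * n) \<omega>))) \<partial>M)"
    unfolding mgf_def
  proof (intro nn_integral_cong_AE)
    show "AE \<omega> in M. ennreal (exp (t * X \<omega>)) = liminf (\<lambda>n. ennreal (exp (t * partial_perpetuity (k * n) \<omega>)))"
      using summable
    proof eventually_elim
      case (elim \<omega>)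
      then have "(\<lambda>n. partial_perpetuity n \<omega>) \<longlonglongrightarrow> X \<omega>"
        unfolding partial_perpetuity_def perpetuity_def by (rule summable_LIMSEQ)
      moreover have "filterlim (\<lambda>n. k * n) at_top sequentially" using k by (simp add: mult_nat_left_at_top)
      ultimately have "(\<lambda>n. partial_perpetuity (k * n) \<omega>) \<longlonglongrightarrow> X \<omega>" by (rule filterlim_compose)
      then have "(\<lambda>n. ennreal (exp (t * partial_perpetuity (k * n) \<omega>))) \<longlonglongrightarrow> ennreal (exp (t * X \<omega>))"
        by (intro tendsto_intros)
      then show ?case using lim_imp_Liminf[OF sequentially_bot] by metis
    qed
  qed
  also have "\<dots> \<le> liminf (\<lambda>n. \<integral>\<^sup>+\<omega>. ennreal (exp (t * partial_perpetuity (k * n) \<omega>)) \<partial>M)"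
    by (rule nn_integral_liminf) measurable
  also have "\<dots> \<le> C"
    using bound by (intro Liminf_le[OF sequentially_bot] always_eventually allI)
      (simp add: iterate_eq_partial_perpetuity_mgf)
  finally show ?thesis .
qed

text \<open>With \<open>A \<noteq> -1\<close> and \<open>B \<ge> 0\<close> almost everywhere, the
  condition on \<open>\<bar>A\<bar> = 1\<close> needed to bound the iterates reduces to the one on
  \<open>A = 1\<close>.\<close>

lemma mgf_finite_if_B_nonneg:
  assumes r: "0 < r" and A1: "AE \<omega> in M. \<bar>A \<omega>\<bar> \<le> 1" and Am1: "AE \<omega> in M. A \<omega> \<noteq> - 1" and B0: "AE \<omega> in M. 0 \<le> B \<omega>"
    and fin: "(\<integral>\<^sup>+\<omega>. ennreal (exp (r * B \<omega>)) \<partial>M) < \<infinity>"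
    and less1: "(\<integral>\<^sup>+\<omega>. ennreal (exp (r * B \<omega>) * indicator {\<omega>. A \<omega> = 1} \<omega>) \<partial>M) < 1"
  shows "mgf r < \<infinity>"
proof -
  have "(\<integral>\<^sup>+\<omega>. ennreal (exp (r * max 0 (B \<omega>)) * indicator {\<omega>. \<bar>A \<omega>\<bar> = 1} \<omega>) \<partial>M)
    = (\<integral>\<^sup>+\<omega>. ennreal (exp (r * B \<omega>) * indicator {\<omega>. A \<omega> = 1} \<omega>) \<partial>M)"
  proof (rule nn_integral_cong_AE)
    show "AE \<omega> in M. ennreal (exp (r * max 0 (B \<omega>)) * indicator {\<omega>. \<bar>A \<omega>\<bar> = 1} \<omega>)
      = ennreal (exp (r * B \<omega>) * indicator {\<omega>. A \<omega> = 1} \<omega>)"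
      using B0 Am1 by eventually_elim (auto split: split_indicator simp: abs_if)
  qed
  then obtain C where C: "\<And>n. (affine_smoothing M A B ^^ n) (\<lambda>_. 1) r \<le> ennreal C"
    using affine_smoothing_iterates_bounded[OF prob_space_axioms A_measurable B_measurable r A1 _ fin] B0 less1 by metis
  have "mgf r \<le> ennreal C" by (rule mgf_le[of 1]) (simp_all add: C)
  then show ?thesis by (rule le_less_trans) simp
qed

text \<open>Composing two independent affine maps \<open>x \<mapsto> B + A * x\<close> gives an
  affine map whose coefficients live on the product space.\<close>

lemma two_step_affine_smoothing:
  assumes [measurable]: "g \<in> borel_measurable borel"
  shows "affine_smoothing (M \<Otimes>\<^sub>M M) (\<lambda>p. A (fst p) * A (snd p)) (\<lambda>p. B (fst p) + A (fst p) * B (snd p)) g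
    = affine_smoothing M A B (affine_smoothing M A B g)"
proof
  fix t
  have "affine_smoothing (M \<Otimes>\<^sub>M M) (\<lambda>p. A (fst p) * A (snd p)) (\<lambda>p. B (fst p) + A (fst p) * B (snd p)) g t
    = (\<integral>\<^sup>+x. \<integral>\<^sup>+y. ennreal (exp (t * (B x + A x * B y))) * g (t * (A x * A y)) \<partial>M \<partial>M)"
    unfolding affine_smoothing_def by (subst nn_integral_fst[symmetric]) auto
  also have "\<dots> = affine_smoothing M A B (affine_smoothing M A B g) t"
    unfolding affine_smoothing_def
    by (subst nn_integral_cmult[symmetric])
      (auto intro!: nn_integral_cong simp: ennreal_mult' exp_add algebra_simps)
  finally show "affine_smoothing (M \<Otimes>\<^sub>M M) (\<lambda>p. A (fst p) * A (snd p)) (\<lambda>p. B (fst p) + A (fst p) * B (snd p)) g t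
    = affine_smoothing M A B (affine_smoothing M A B g) t" .
qed

text \<open>Two steps turn negative multipliers into a product strictly between \<open>0\<close> and
  \<open>1\<close>. Hence the event of modulus \<open>1\<close> is null, and no sign condition on
  the additive part is needed.\<close>

lemma mgf_finite_if_A_neg:
  assumes r: "0 < r" and A1: "AE \<omega> in M. \<bar>A \<omega>\<bar> \<le> 1" and Am1: "AE \<omega> in M. A \<omega> \<noteq> - 1" and A0: "AE \<omega> in M. A \<omega> < 0"
    and fin: "(affine_smoothing M A B ^^ 2) (\<lambda>_. 1) r < \<infinity>"
  shows "mgf r < \<infinity>"
proof -
  let ?A = "\<lambda>p. A (fst p) * A (snd p)" and ?B = "\<lambda>p. B (fst p) + A (fst p) * B (snd p)"
  interpret MM: pair_prob_space M M ..
  have iterate: "(affine_smoothing (M \<Otimes>\<^sub>M M) ?A ?B ^^ n) (\<lambda>_. 1) = (affine_smoothing M A B ^^ (2 * n)) (\<lambda>_. 1)" for n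
  proof (induction n)
    case (Suc n)
    then show ?case
      by (simp add: two_step_affine_smoothing iterate_affine_smoothing_measurable sigma_finite_measure_axioms)
  qed simp
  have "AE \<omega> in M. A \<omega> \<in> {-1<..<0}" using A1 Am1 A0 by eventually_elim auto
  then have "AE x in M. AE y in M. \<bar>A x * A y\<bar> < 1 \<and> 0 \<le> A x * A y"
  proof eventually_elim
    case (elim x)
    from \<open>AE \<omega> in M. A \<omega> \<in> {-1<..<0}\<close> show ?case
    proof eventually_elim
      case (elim y)
      have "\<bar>A x\<bar> * \<bar>A y\<bar> < 1 * 1" using elim \<open>A x \<in> {-1<..<0}\<close> by (intro mult_strict_mono) auto
      then show ?case using elim \<open>A x \<in> {-1<..<0}\<close> by (auto simp: abs_mult mult_nonpos_nonpos)
    qed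
  qed
  then have AE: "AE p in M \<Otimes>\<^sub>M M. \<bar>?A p\<bar> < 1 \<and> 0 \<le> ?A p"
    by (subst (asm) MM.AE_pair_iff) (auto simp: split_beta')
  have "(\<integral>\<^sup>+p. ennreal (exp (r * max 0 (?B p)) * indicator {p. \<bar>?A p\<bar> = 1} p) \<partial>(M \<Otimes>\<^sub>M M)) = (\<integral>\<^sup>+p. 0 \<partial>(M \<Otimes>\<^sub>M M))"
    by (rule nn_integral_cong_AE, rule eventually_mono[OF AE]) auto
  then have less1: "(\<integral>\<^sup>+p. ennreal (exp (r * max 0 (?B p)) * indicator {p. \<bar>?A p\<bar> = 1} p) \<partial>(M \<Otimes>\<^sub>M M)) < 1" by simp
  have fin': "(\<integral>\<^sup>+p. ennreal (exp (r * ?B p)) \<partial>(M \<Otimes>\<^sub>M M)) < \<infinity>"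
    using fin fun_cong[OF iterate[of 1], of r] by (simp add: affine_smoothing_def)
  obtain C where C: "\<And>n. (affine_smoothing (M \<Otimes>\<^sub>M M) ?A ?B ^^ n) (\<lambda>_. 1) r \<le> ennreal C"
    by (rule affine_smoothing_iterates_bounded[of "M \<Otimes>\<^sub>M M" ?A ?B r])
      (use AE r less1 fin' MM.P.prob_space_axioms in \<open>auto elim!: eventually_mono\<close>)
  have "mgf r \<le> ennreal C" by (rule mgf_le[of 2]) (simp_all add: C[unfolded iterate])
  then show ?thesis by (rule le_less_trans) simp
qed

end

section \<open>The two equivalences\<close>

theorem theorem4p6:
  fixes M :: "'a measure" and A B :: "'a \<Rightarrow> real"
    and As Bs :: "nat \<Rightarrow> 'a \<Rightarrow> real" and r :: real
  assumes "prob_space M"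
    and "A \<in> borel_measurable M" and "B \<in> borel_measurable M"
    and "\<And>n. As n \<in> borel_measurable M" and "\<And>n. Bs n \<in> borel_measurable M"
    and "prob_space.indep_vars M (\<lambda>_. borel) (\<lambda>n \<omega>. (As n \<omega>, Bs n \<omega>)) {1..}"
    and "\<And>n. n \<ge> 1 \<Longrightarrow>
           distr M borel (\<lambda>\<omega>. (As n \<omega>, Bs n \<omega>)) = distr M borel (\<lambda>\<omega>. (A \<omega>, B \<omega>))"
    and "AE \<omega> in M. summable (\<lambda>j. Pi_prod As j \<omega> * Bs (Suc j) \<omega>)"
    and "\<P>(\<omega> in M. A \<omega> = 0) = 0"
    and "\<P>(\<omega> in M. B \<omega> = 0) < 1"
    and "\<And>c. \<P>(\<omega> in M. B \<omega> + A \<omega> * c = c) < 1"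
    and "\<P>(\<omega> in M. A \<omega> = -1) = 0"
    and "r > 0"
  shows "(\<P>(\<omega> in M. A \<omega> < 0) * \<P>(\<omega> in M. A \<omega> > 0) > 0 \<and> \<P>(\<omega> in M. B \<omega> \<ge> 0) = 1 \<longrightarrow>
           ((\<integral>\<^sup>+\<omega>. ennreal (exp (r * perpetuity As Bs \<omega>)) \<partial>M) < \<infinity> \<longleftrightarrow>
             \<P>(\<omega> in M. \<bar>A \<omega>\<bar> \<le> 1) = 1 \<and>
             (\<integral>\<^sup>+\<omega>. ennreal (exp (r * B \<omega>)) \<partial>M) < \<infinity> \<and>
             (\<integral>\<^sup>+\<omega>. ennreal (exp (r * B \<omega>) * indicator {\<omega>. A \<omega> = 1} \<omega>) \<partial>M) < 1))
       \<and> (\<P>(\<omega> in M. A \<omega> < 0) = 1 \<longrightarrow>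
           ((\<integral>\<^sup>+\<omega>. ennreal (exp (r * perpetuity As Bs \<omega>)) \<partial>M) < \<infinity> \<longleftrightarrow>
             \<P>(\<omega> in M. \<bar>A \<omega>\<bar> \<le> 1) = 1 \<and>
             (\<integral>\<^sup>+\<omega>. ennreal (exp (r * (Bs 1 \<omega> + As 1 \<omega> * Bs 2 \<omega>))) \<partial>M) < \<infinity>))"
proof -
  interpret prob_space M by fact
  note [measurable] = assms(2-5)
  have nz: "AE \<omega> in M. A \<omega> \<noteq> 0" and nm1: "AE \<omega> in M. A \<omega> \<noteq> - 1"
    using assms(9,12) by (auto simp: prob_Collect_eq_0)
  interpret iid_perpetuity M A B As Bs
    using assms nz by unfold_locales auto
  let ?J = "\<integral>\<^sup>+\<omega>. ennreal (exp (r * B \<omega>) * indicator {\<omega>. A \<omega> = 1} \<omega>) \<partial>M"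
  have mgf: "(\<integral>\<^sup>+\<omega>. ennreal (exp (r * perpetuity As Bs \<omega>)) \<partial>M) = mgf r" by (simp add: mgf_def)
  have le1: "\<P>(\<omega> in M. \<bar>A \<omega>\<bar> \<le> 1) = 1 \<longleftrightarrow> (AE \<omega> in M. \<bar>A \<omega>\<bar> \<le> 1)" by (simp add: prob_Collect_eq_1)
  have nonconst: "\<not> (AE \<omega> in M. X \<omega> = c)" for c using X_nonconst assms(11) by blast
  have iter1: "(affine_smoothing M A B ^^ 1) (\<lambda>_. 1) r = (\<integral>\<^sup>+\<omega>. ennreal (exp (r * B \<omega>)) \<partial>M)"
    by (simp add: affine_smoothing_def)
  \<comment> \<open>The second partial sum is \<open>Bs 1 + As 1 * Bs 2\<close>, so the
    integrability condition of part (2) is finiteness of the second iterate, as that of part (1) is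
    finiteness of the first.\<close>
  have iter2: "(affine_smoothing M A B ^^ 2) (\<lambda>_. 1) r = (\<integral>\<^sup>+\<omega>. ennreal (exp (r * (Bs 1 \<omega> + As 1 \<omega> * Bs 2 \<omega>))) \<partial>M)"
    unfolding iterate_eq_partial_perpetuity_mgf by (simp add: partial_perpetuity_def Pi_prod_def numeral_2_eq_2)
  have part1: "mgf r < \<infinity> \<longleftrightarrow> (AE \<omega> in M. \<bar>A \<omega>\<bar> \<le> 1) \<and> (\<integral>\<^sup>+\<omega>. ennreal (exp (r * B \<omega>)) \<partial>M) < \<infinity> \<and> ?J < 1"
    if "\<P>(\<omega> in M. A \<omega> < 0) * \<P>(\<omega> in M. A \<omega> > 0) > 0" and "\<P>(\<omega> in M. B \<omega> \<ge> 0) = 1"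
  proof -
    have "\<P>(\<omega> in M. A \<omega> < 0) \<noteq> 0" using that(1) by auto
    then have neg: "\<not> (AE \<omega> in M. 0 \<le> A \<omega>)" by (simp add: prob_Collect_eq_0 not_less)
    have ne1: "\<not> (AE \<omega> in M. A \<omega> = 1)"
    proof
      assume "AE \<omega> in M. A \<omega> = 1"
      then have "AE \<omega> in M. 0 \<le> A \<omega>" by eventually_elim simp
      with neg show False by contradiction
    qed
    have B0: "AE \<omega> in M. 0 \<le> B \<omega>" using that(2) by (simp add: prob_Collect_eq_1)
    show ?thesis
      using abs_le_1[OF nonconst \<open>r > 0\<close> _ neg] finite_iterate[of r 1] nn_integral_exp_indicator_less_1[OF _ ne1]
        mgf_finite_if_B_nonneg[OF \<open>r > 0\<close> _ nm1 B0] \<open>r > 0\<close> unfolding iter1 by blast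
  qed
  have part2: "mgf r < \<infinity> \<longleftrightarrow> (AE \<omega> in M. \<bar>A \<omega>\<bar> \<le> 1) \<and>
      (\<integral>\<^sup>+\<omega>. ennreal (exp (r * (Bs 1 \<omega> + As 1 \<omega> * Bs 2 \<omega>))) \<partial>M) < \<infinity>"
    if "\<P>(\<omega> in M. A \<omega> < 0) = 1"
  proof -
    have A0: "AE \<omega> in M. A \<omega> < 0" using that by (simp add: prob_Collect_eq_1)
    have neg: "\<not> (AE \<omega> in M. 0 \<le> A \<omega>)"
    proof
      assume "AE \<omega> in M. 0 \<le> A \<omega>"
      with A0 have "AE \<omega> in M. False" by eventually_elim simp
      then show False by simp
    qed
    show ?thesis
      using abs_le_1[OF nonconst \<open>r > 0\<close> _ neg] finite_iterate[of r 2]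
        mgf_finite_if_A_neg[OF \<open>r > 0\<close> _ nm1 A0] \<open>r > 0\<close> unfolding iter2 by blast
  qed
  show ?thesis unfolding mgf le1 using part1 part2 by blast
qed

end
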